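(* Let $(X,\rho,\mu)$ be a space of homogeneous type with quasi-metric constant $\kappa_0$ and doubling constant $\kappa_1$, and let $\mathcal{D}$ be a dyadic lattice on $X$ such that the Lebesgue Differentiation Theorem holds with respect to the cubes in $\mathcal{D}$. Let $1<p<\infty$ and let $w\in RH_p^d$. Then there exists $\epsilon>0$, depending only on $p$, $w$, $\kappa_0$ and $\kappa_1$, such that $w\in RH_{p+\epsilon}^d$.
   Context: A quasi-metric space $(X,\rho)$ is a set $X$ with $\rho:X\times X\to[0,\infty)$ satisfying all axioms of a metric except the triangle inequality, in place of which there is a constant $\kappa_0>0$ with $\rho(x,y)\le\kappa_0(\rho(x,z)+\rho(z,y))$ for all $x,y,z\in X$. Open balls are $B(x,r)=\{y\in X:\rho(x,y)<r\}$. A space of homogeneous type $(X,\rho,\mu)$ is a quasi-metric space with a measure $\mu$ whose $\sigma$-algebra contains the Borel sets and all open $\rho$-balls, such that $0<\mu(B(x,r))<\infty$ for all $x\in X$, $r>0$, and such that there is a constant $\kappa_1>0$ with $\mu(B(x,2r))\le\kappa_1\mu(B(x,r))$ for all balls. A dyadic lattice on $X$ is a system $\mathcal{D}=\bigcup_{k\in\mathbb{Z}}\mathcal{D}_k$ of (measurable) subsets called cubes, each $\mathcal{D}_k=\{Q_\alpha^k:\alpha\in\mathcal{A}_k\}$ being a countable family, such that: (1) for each $k$, $\mathcal{D}_k$ is a partition of $X$; (2) if $k\ge\ell$, $Q\in\mathcal{D}_k$, $Q'\in\mathcal{D}_\ell$, then either $Q\subseteq Q'$ or $Q\cap Q'=\emptyset$;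 (3) there are constants $0<r_0\le R_0<\infty$ and $0<\delta<1$ such that for every $k$ and every $Q\in\mathcal{D}_k$ there is $z\in Q$ with $B(z,r_0\delta^k)\subseteq Q\subseteq B(z,R_0\delta^k)$. The Lebesgue Differentiation Theorem holds with respect to cubes in $\mathcal{D}$ if for every locally integrable $f$ on $X$, for $\mu$-a.e. $x$, $\lim_{k\to\infty}\frac{1}{\mu(Q_x^k)}\int_{Q_x^k}f\,d\mu=f(x)$, where $Q_x^k$ is the cube of $\mathcal{D}_k$ containing $x$. A weight is a nonnegative locally integrable function on $X$ (integrable on every ball). Write $\langle f\rangle_S=\frac{1}{\mu(S)}\int_S f\,d\mu$. For $1<q<\infty$, a weight $w$ belongs to the dyadic reverse Hölder class $RH_q^d$ if there is a constant $C$ such that $\langle w^q\rangle_Q^{1/q}\le C\langle w\rangle_Q$ for all $Q\in\mathcal{D}$; the smallest such $C$ is $[w]_{RH_q^d}$.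
   Formalization: ε may also depend on the lattice constants r₀, R₀, δ (without them the uniform claim fails, e.g. for N-adic intervals), and on w through [w]_{RH_p^d}; it is uniform over spaces in one fixed underlying set, which may be taken to be the reals as such spaces have at most continuum many points. *)

theory Defs
  imports "HOL-Analysis.Analysis"
begin

section \<open>Spaces of homogeneous type\<close>

definition quasi_metric :: "'a set \<Rightarrow> ('a \<Rightarrow> 'a \<Rightarrow> real) \<Rightarrow> real \<Rightarrow> bool" where
  "quasi_metric X \<rho> \<kappa>\<^sub>0 \<longleftrightarrow>
     \<kappa>\<^sub>0 > 0 \<and>
     (\<forall>x\<in>X. \<forall>y\<in>X. 0 \<le> \<rho> x y) \<and>
     (\<forall>x\<in>X. \<forall>y\<in>X. \<rho> x y = 0 \<longleftrightarrow> x = y) \<and>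
     (\<forall>x\<in>X. \<forall>y\<in>X. \<rho> x y = \<rho> y x) \<and>
     (\<forall>x\<in>X. \<forall>y\<in>X. \<forall>z\<in>X. \<rho> x y \<le> \<kappa>\<^sub>0 * (\<rho> x z + \<rho> z y))"

definition qball :: "'a set \<Rightarrow> ('a \<Rightarrow> 'a \<Rightarrow> real) \<Rightarrow> 'a \<Rightarrow> real \<Rightarrow> 'a set" where
  "qball X \<rho> x r = {y \<in> X. \<rho> x y < r}"

text \<open>The topology induced by a quasi-metric. The balls themselves need not be open in it, which
  is why their measurability is a separate axiom below.\<close>

definition quasi_open :: "'a set \<Rightarrow> ('a \<Rightarrow> 'a \<Rightarrow> real) \<Rightarrow> 'a set \<Rightarrow> bool" where
  "quasi_open X \<rho> U \<longleftrightarrow> U \<subseteq> X \<and> (\<forall>x\<in>U. \<exists>r>0. qball X \<rho> x r \<subseteq> U)"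

text \<open>The underlying set is \<open>space M\<close>, so that statements may range over all spaces of homogeneous
  type carried by subsets of the type \<open>'a\<close>.\<close>

definition homogeneous_type_space ::
    "'a measure \<Rightarrow> ('a \<Rightarrow> 'a \<Rightarrow> real) \<Rightarrow> real \<Rightarrow> real \<Rightarrow> bool" where
  "homogeneous_type_space M \<rho> \<kappa>\<^sub>0 \<kappa>\<^sub>1 \<longleftrightarrow>
     quasi_metric (space M) \<rho> \<kappa>\<^sub>0 \<and>
     sigma_sets (space M) {U. quasi_open (space M) \<rho> U} \<subseteq> sets M \<and>
     (\<forall>x\<in>space M. \<forall>r>0. qball (space M) \<rho> x r \<in> sets M) \<and>
     (\<forall>x\<in>space M. \<forall>r>0. 0 < emeasure M (qball (space M) \<rho> x r) \<and>
                            emeasure M (qball (space M) \<rho> x r) < \<infinity>) \<and>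
     \<kappa>\<^sub>1 > 0 \<and>
     (\<forall>x\<in>space M. \<forall>r>0. emeasure M (qball (space M) \<rho> x (2 * r))
                            \<le> ennreal \<kappa>\<^sub>1 * emeasure M (qball (space M) \<rho> x r))"

section \<open>Dyadic lattices\<close>

definition dyadic_lattice ::
    "'a measure \<Rightarrow> ('a \<Rightarrow> 'a \<Rightarrow> real) \<Rightarrow> (int \<Rightarrow> 'a set set) \<Rightarrow> real \<Rightarrow> real \<Rightarrow> real \<Rightarrow> bool" where
  "dyadic_lattice M \<rho> \<D> r\<^sub>0 R\<^sub>0 \<delta> \<longleftrightarrow>
     0 < r\<^sub>0 \<and> r\<^sub>0 \<le> R\<^sub>0 \<and> 0 < \<delta> \<and> \<delta> < 1 \<and>
     (\<forall>k. countable (\<D> k) \<and> \<D> k \<subseteq> sets M \<and> partition_on (space M) (\<D> k)) \<and>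
     (\<forall>k l. \<forall>Q\<in>\<D> k. \<forall>Q'\<in>\<D> l. l \<le> k \<longrightarrow> Q \<subseteq> Q' \<or> Q \<inter> Q' = {}) \<and>
     (\<forall>k. \<forall>Q\<in>\<D> k. \<exists>z\<in>Q. qball (space M) \<rho> z (r\<^sub>0 * \<delta> powi k) \<subseteq> Q \<and>
                            Q \<subseteq> qball (space M) \<rho> z (R\<^sub>0 * \<delta> powi k))"

definition cube_at :: "(int \<Rightarrow> 'a set set) \<Rightarrow> int \<Rightarrow> 'a \<Rightarrow> 'a set" where
  "cube_at \<D> k x = (THE Q. Q \<in> \<D> k \<and> x \<in> Q)"

definition average :: "'a measure \<Rightarrow> 'a set \<Rightarrow> ('a \<Rightarrow> real) \<Rightarrow> real" where
  "average M S f = (LINT x:S|M. f x) / measure M S"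

definition locally_integrable :: "'a measure \<Rightarrow> ('a \<Rightarrow> 'a \<Rightarrow> real) \<Rightarrow> ('a \<Rightarrow> real) \<Rightarrow> bool" where
  "locally_integrable M \<rho> f \<longleftrightarrow>
     (\<forall>x\<in>space M. \<forall>r>0. set_integrable M (qball (space M) \<rho> x r) f)"

definition lebesgue_differentiation ::
    "'a measure \<Rightarrow> ('a \<Rightarrow> 'a \<Rightarrow> real) \<Rightarrow> (int \<Rightarrow> 'a set set) \<Rightarrow> bool" where
  "lebesgue_differentiation M \<rho> \<D> \<longleftrightarrow>
     (\<forall>f. locally_integrable M \<rho> f \<longrightarrow>
        (AE x in M. ((\<lambda>k. average M (cube_at \<D> k x) f) \<longlongrightarrow> f x) at_top))"

section \<open>Dyadic reverse Hoelder classes\<close>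

definition weight :: "'a measure \<Rightarrow> ('a \<Rightarrow> 'a \<Rightarrow> real) \<Rightarrow> ('a \<Rightarrow> real) \<Rightarrow> bool" where
  "weight M \<rho> w \<longleftrightarrow> (\<forall>x\<in>space M. 0 \<le> w x) \<and> locally_integrable M \<rho> w"

text \<open>Integrability of \<open>w\<^sup>q\<close> on the cubes is explicit because the Bochner integral of a
  non-integrable function is \<open>0\<close> rather than \<open>\<infinity>\<close>. The restriction \<open>0 \<le> C\<close> only
  matters for \<open>w = 0\<close>, where negative constants would otherwise be admissible and there would be
  no smallest one.\<close>

definition reverse_hoelder_bound ::
    "'a measure \<Rightarrow> (int \<Rightarrow> 'a set set) \<Rightarrow> real \<Rightarrow> ('a \<Rightarrow> real) \<Rightarrow> real \<Rightarrow> bool" where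
  "reverse_hoelder_bound M \<D> q w C \<longleftrightarrow>
     0 \<le> C \<and>
     (\<forall>k. \<forall>Q\<in>\<D> k. set_integrable M Q (\<lambda>x. w x powr q) \<and>
                       average M Q (\<lambda>x. w x powr q) powr (1 / q) \<le> C * average M Q w)"

definition RH_dyadic ::
    "'a measure \<Rightarrow> ('a \<Rightarrow> 'a \<Rightarrow> real) \<Rightarrow> (int \<Rightarrow> 'a set set) \<Rightarrow> real \<Rightarrow> ('a \<Rightarrow> real) set" where
  "RH_dyadic M \<rho> \<D> q = {w. weight M \<rho> w \<and> (\<exists>C. reverse_hoelder_bound M \<D> q w C)}"

definition RH_dyadic_const ::
    "'a measure \<Rightarrow> (int \<Rightarrow> 'a set set) \<Rightarrow> real \<Rightarrow> ('a \<Rightarrow> real) \<Rightarrow> real" where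
  "RH_dyadic_const M \<D> q w = Inf {C. reverse_hoelder_bound M \<D> q w C}"

end

theory Submission imports Defs begin

text \<open>
  This is Gehring's self-improvement of reverse Hoelder inequalities, for dyadic cubes. Although
  \<open>w\<close> itself need not be doubling, \<open>\<mu>\<close> is, so a cube and its parent have comparable measures, with
  ratio at most some \<open>A\<close>. That is the only information on the geometry that is used; the rest is a
  stopping-time argument inside one cube \<open>Q\<^sub>0\<close>.

  For a level \<open>l \<ge> \<langle>w\<rangle>\<^bsub>Q\<^sub>0\<^esub>\<close> stop at the maximal subcubes \<open>Q\<close> of \<open>Q\<^sub>0\<close> with \<open>\<langle>w\<rangle>\<^bsub>Q\<^esub> > l\<close>, and let
  \<open>\<Omega>(l)\<close> be their union. The parent of a stopping cube has average at most \<open>l\<close>, whence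
  \<open>\<langle>w\<rangle>\<^bsub>Q\<^esub> \<le> A l\<close>. A weak-type estimate inside \<open>Q\<close> then gives \<open>\<mu>(\<Omega>(a l) \<inter> Q) \<le> (A/a) \<mu>(Q)\<close>
  (\<open>measure_superlevel_Int_le\<close>), so a large ratio \<open>a\<close> makes the next superlevel set occupy only a
  small proportion of \<open>Q\<close>.

  The reverse Hoelder inequality on \<open>Q\<close> says that \<open>w\<close> is not concentrated: a subset of small
  proportion carries at most a fraction \<open>\<theta> < 1\<close> of \<open>\<integral>\<^bsub>Q\<^esub> w\<^sup>p\<close>
  (\<open>set_integral_powr_le_of_small_measure\<close>). Summing over the stopping cubes gives
  \<open>\<integral>\<^bsub>\<Omega>(a l)\<^esub> w\<^sup>p \<le> \<theta> \<integral>\<^bsub>\<Omega>(l)\<^esub> w\<^sup>p\<close>, and hence geometric decay of \<open>\<integral> w\<^sup>p\<close> over the sets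
  \<open>\<Omega>(a\<^sup>k l)\<close>.

  By the differentiation theorem almost every point with \<open>w > a\<^sup>k l\<close> lies in \<open>\<Omega>(a\<^sup>k l)\<close>. Splitting
  \<open>Q\<^sub>0\<close> by the size of \<open>w\<close> therefore bounds the integral of \<open>w\<close> to the power \<open>p + \<epsilon>\<close> by a geometric
  series of ratio \<open>a\<^sup>\<epsilon> \<theta>\<close>, which converges for small \<open>\<epsilon>\<close> (\<open>higher_power_nn_integral_le\<close>). Both \<open>a\<close> and
  \<open>\<theta>\<close> depend only on \<open>p\<close>, the reverse Hoelder constant and \<open>A\<close>, so \<open>\<epsilon>\<close> is uniform.
\<close>

section \<open>Small subsets carry a small part of the power integral\<close>



text \<open>
  Below the threshold \<open>t\<close> the first summand suffices, above it the second one does because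
  \<open>y = y\<^sup>p y\<^bsup>1-p\<^esup>\<close>. With \<open>t\<close> chosen well this replaces Hoelder's inequality below.
\<close>

lemma le_threshold_plus_powr:
  fixes p t y :: real
  assumes "1 < p" "0 < t" "0 \<le> y"
  shows "y \<le> t + t powr (1 - p) * y powr p"
proof (cases "y \<le> t")
  case True
  then show ?thesis using assms by (simp add: add_increasing2)
next
  case False
  have "t powr (1 - p) * y powr p \<ge> y powr (1 - p) * y powr p"
    using False assms by (intro mult_right_mono powr_mono2') auto
  also have "y powr (1 - p) * y powr p = y"
    using False assms by (simp flip: powr_add)
  finally show ?thesis using assms by simp
qed

lemma set_integral_le_threshold_plus_powr:
  fixes w :: "'a \<Rightarrow> real"
  assumes "1 < p" "0 < t" "\<And>x. x \<in> E \<Longrightarrow> 0 \<le> w x" "E \<in> fmeasurable M"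
    and "set_integrable M E w" "set_integrable M E (\<lambda>x. w x powr p)"
  shows "(LINT x:E|M. w x) \<le> t * measure M E + t powr (1 - p) * (LINT x:E|M. w x powr p)"
proof -
  have i1: "set_integrable M E (\<lambda>x. t)"
    using assms(4) by (auto simp: set_integrable_def fmeasurable_def)
  have i2: "set_integrable M E (\<lambda>x. t powr (1 - p) * w x powr p)"
    using assms(6) by simp
  have "(LINT x:E|M. w x) \<le> (LINT x:E|M. t + t powr (1 - p) * w x powr p)"
    using assms i1 i2 by (intro set_integral_mono le_threshold_plus_powr set_integral_add) auto
  also have "\<dots> = (LINT x:E|M. t) + (LINT x:E|M. t powr (1 - p) * w x powr p)"
    using i1 i2 by (intro set_integral_add) auto
  also have "(LINT x:E|M. t) = t * measure M E"
    using assms(4) by (simp add: set_lebesgue_integral_def fmeasurable_def)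
  finally show ?thesis by simp
qed

text \<open>
  Write \<open>m\<close> for the average of \<open>w\<close> over \<open>Q\<close>. On \<open>E\<close> the threshold \<open>c m\<close> is used: both summands
  contribute at most \<open>m \<mu>(Q) / 4\<close>, the first because \<open>E\<close> is small, the second because of the reverse
  Hoelder inequality and the size of \<open>c\<close>. So at least half of the integral of \<open>w\<close> lies in \<open>Q - E\<close>.
  There the threshold \<open>m / 4\<close> accounts for at most half of that, and the remaining \<open>m \<mu>(Q) / 4\<close> must
  come from \<open>w\<^sup>p\<close>. This bounds the integral of \<open>w\<^sup>p\<close> over \<open>Q - E\<close> from below.
\<close>

lemma set_integral_powr_le_of_small_measure:
  fixes w :: "'a \<Rightarrow> real"
  assumes p: "1 < p" and K: "1 \<le> K" and c: "0 < c" "c powr (1 - p) * K powr p \<le> 1/4"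
    and E: "E \<in> sets M" "E \<subseteq> Q" and Q: "Q \<in> fmeasurable M"
    and w: "\<And>x. x \<in> Q \<Longrightarrow> 0 \<le> w x"
    and int: "set_integrable M Q w" "set_integrable M Q (\<lambda>x. w x powr p)"
    and m: "0 < average M Q w"
    and RH: "average M Q (\<lambda>x. w x powr p) \<le> (K * average M Q w) powr p"
    and small: "measure M E \<le> measure M Q / (4 * c)"
  shows "(LINT x:E|M. w x powr p) \<le> (1 - (4 * K) powr (-p)) * (LINT x:Q|M. w x powr p)"
proof -
  define m where "m = average M Q w"
  define V where "V = (LINT x:Q|M. w x powr p)"
  have m0: "0 < m" using m by (simp add: m_def)
  have Q0: "0 < measure M Q"
    using m by (auto simp: average_def zero_less_divide_iff zero_less_measure_iff)
  have Ef: "E \<in> fmeasurable M" and Df: "Q - E \<in> fmeasurable M"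
    using E Q by (auto intro: fmeasurableI2)
  have sub: "set_integrable M S f" if "S \<in> fmeasurable M" "S \<subseteq> Q" "set_integrable M Q f" for S and f :: "'a \<Rightarrow> real"
    using set_integrable_subset[OF that(3) _ that(2)] that(1) by auto
  have split: "(LINT x:Q|M. f x) = (LINT x:E|M. f x) + (LINT x:Q-E|M. f x)"
    if "set_integrable M Q f" for f :: "'a \<Rightarrow> real"
  proof -
    have "Q = E \<union> (Q - E)" using E by auto
    then show ?thesis using that E Ef Df
      by (metis Diff_disjoint Diff_subset set_integral_Un sub)
  qed
  have Vle: "V \<le> K powr p * m powr p * measure M Q"
  proof -
    have "V / measure M Q \<le> (K * m) powr p"
      using RH by (simp add: average_def[of M Q "\<lambda>x. w x powr p"] V_def m_def)
    then show ?thesis using Q0 K m0 by (simp add: powr_mult pos_divide_le_eq)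
  qed
  have mQ: "(LINT x:Q|M. w x) = m * measure M Q"
    using Q0 by (simp add: m_def average_def)
  have VE: "(LINT x:E|M. w x powr p) \<le> V"
  proof -
    have "0 \<le> (LINT x:Q-E|M. w x powr p)"
      by (auto simp: set_lebesgue_integral_def intro!: Bochner_Integration.integral_nonneg)
    then show ?thesis using split[OF int(2)] by (simp add: V_def)
  qed
  have "(LINT x:E|M. w x) \<le> (c * m) * measure M E + (c * m) powr (1 - p) * (LINT x:E|M. w x powr p)"
    using E w c m0 p Ef sub int by (intro set_integral_le_threshold_plus_powr) auto
  also have "\<dots> \<le> (c * m) * (measure M Q / (4 * c)) + (c * m) powr (1 - p) * (K powr p * m powr p * measure M Q)"
    using small VE Vle c m0 by (intro add_mono mult_left_mono) auto
  also have "\<dots> = m * measure M Q / 4 + (c powr (1-p) * K powr p) * (m powr (1-p) * m powr p) * measure M Q"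
    using c m0 by (simp add: powr_mult)
  also have "m powr (1-p) * m powr p = m" using m0 by (simp flip: powr_add)
  also have "m * measure M Q / 4 + (c powr (1-p) * K powr p) * m * measure M Q
      \<le> m * measure M Q / 4 + 1/4 * m * measure M Q"
    using c(2) m0 Q0 by (intro add_mono mult_right_mono) auto
  finally have 1: "(LINT x:E|M. w x) \<le> m * measure M Q / 2" by simp
  have "(LINT x:Q-E|M. w x) \<le> (m/4) * measure M (Q-E) + (m/4) powr (1 - p) * (LINT x:Q-E|M. w x powr p)"
    using E w c m0 p Df sub int by (intro set_integral_le_threshold_plus_powr) auto
  also have "\<dots> \<le> (m/4) * measure M Q + (m/4) powr (1 - p) * (LINT x:Q-E|M. w x powr p)"
    using m0 Q E by (intro add_mono mult_left_mono measure_mono_fmeasurable) auto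
  finally have 2: "(m/4) * measure M Q \<le> (m/4) powr (1 - p) * (LINT x:Q-E|M. w x powr p)"
    using 1 split[OF int(1)] mQ by linarith
  have "(m/4) powr p * measure M Q = (m/4) powr (p - 1) * ((m/4) * measure M Q)"
    using m0 by (simp add: powr_diff)
  also have "\<dots> \<le> (m/4) powr (p - 1) * ((m/4) powr (1 - p) * (LINT x:Q-E|M. w x powr p))"
    using 2 by (intro mult_left_mono) auto
  also have "\<dots> = ((m/4) powr (p - 1) * (m/4) powr (1 - p)) * (LINT x:Q-E|M. w x powr p)"
    by (simp only: mult.assoc)
  also have "(m/4) powr (p - 1) * (m/4) powr (1 - p) = 1"
    using m0 by (simp flip: powr_add)
  also have "1 * (LINT x:Q-E|M. w x powr p) = (LINT x:Q-E|M. w x powr p)"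
    by simp
  finally have 3: "(m/4) powr p * measure M Q \<le> (LINT x:Q-E|M. w x powr p)" .
  have "(4 * K) powr (-p) * V \<le> (4 * K) powr (-p) * (K powr p * m powr p * measure M Q)"
    using Vle by (intro mult_left_mono) auto
  also have "\<dots> = (m/4) powr p * measure M Q"
  proof -
    have "(m/4) powr p = (inverse (4 * K) * (K * m)) powr p"
      using K by (simp add: field_simps)
    also have "\<dots> = (4 * K) powr (-p) * (K powr p * m powr p)"
      using K m0 by (simp only: powr_mult powr_minus inverse_powr)
    finally show ?thesis by simp
  qed
  finally have "(4 * K) powr (-p) * V \<le> (LINT x:Q-E|M. w x powr p)"
    using 3 by linarith
  then show ?thesis
    using split[OF int(2)] unfolding V_def left_diff_distrib mult_1_left by linarith
qed

section \<open>Stopping cubes inside a fixed cube\<close>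

text \<open>
  Transfers a comparison of two measures on stopping cubes to the union of these cubes. It serves both
  the weak-type estimate and the decay of the integral of \<open>w\<^sup>p\<close>.
\<close>

lemma emeasure_Int_Union_le:
  assumes "countable F" "F \<subseteq> sets M" "disjoint F" "sets N = sets M" "E \<in> sets M"
    and le: "\<And>R. R \<in> F \<Longrightarrow> emeasure M (E \<inter> R) \<le> c * emeasure N R"
  shows "emeasure M (E \<inter> \<Union>F) \<le> c * emeasure N (\<Union>F)"
proof -
  have dis: "disjoint_family_on (\<lambda>R. R) F"
    using assms(3) by (auto simp: disjoint_family_on_def disjoint_def)
  then have disE: "disjoint_family_on (\<lambda>R. E \<inter> R) F"
    by (auto simp: disjoint_family_on_def)
  have "emeasure M (E \<inter> \<Union>F) = emeasure M (\<Union>R\<in>F. E \<inter> R)"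
    by (simp only: Int_Union)
  also have "\<dots> = (\<integral>\<^sup>+R. emeasure M (E \<inter> R) \<partial>count_space F)"
    using assms disE by (intro emeasure_UN_countable) auto
  also have "\<dots> \<le> (\<integral>\<^sup>+R. c * emeasure N R \<partial>count_space F)"
    by (intro nn_integral_mono) (auto simp: le)
  also have "\<dots> = c * (\<integral>\<^sup>+R. emeasure N R \<partial>count_space F)"
    by (simp add: nn_integral_cmult)
  also have "(\<integral>\<^sup>+R. emeasure N R \<partial>count_space F) = emeasure N (\<Union>R\<in>F. R)"
    using assms dis by (intro emeasure_UN_countable[symmetric]) auto
  finally show ?thesis by simp
qed

lemma emeasure_density_eq_set_integral:
  fixes f :: "'a \<Rightarrow> real"
  assumes "f \<in> borel_measurable M" "E \<in> sets M" "\<And>x. x \<in> E \<Longrightarrow> 0 \<le> f x" "set_integrable M E f"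
  shows "emeasure (density M (\<lambda>x. ennreal (f x))) E = ennreal (LINT x:E|M. f x)"
proof -
  have "emeasure (density M (\<lambda>x. ennreal (f x))) E = (\<integral>\<^sup>+x. ennreal (indicator E x *\<^sub>R f x) \<partial>M)"
    using assms by (subst emeasure_density) (auto intro!: nn_integral_cong split: split_indicator)
  also have "\<dots> = ennreal (\<integral>x. indicator E x *\<^sub>R f x \<partial>M)"
    using assms by (intro nn_integral_eq_integral) (auto simp: set_integrable_def split: split_indicator)
  finally show ?thesis by (simp add: set_lebesgue_integral_def)
qed

text \<open>
  The subcubes of one cube \<open>Q\<^sub>0\<close>, with \<open>\<C> n\<close> those lying \<open>n\<close> generations below it. The same set may
  belong to several generations (an isolated point, for instance), so the generation is not a function
  of the cube.
\<close>

locale dyadic_filtration =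
  fixes M :: "'a measure" and Q\<^sub>0 :: "'a set" and \<C> :: "nat \<Rightarrow> 'a set set" and A :: real
  assumes top_cube: "\<C> 0 = {Q\<^sub>0}"
    and countable_cubes: "countable (\<C> n)"
    and sets_cubes: "\<C> n \<subseteq> sets M"
    and partition_cubes: "partition_on Q\<^sub>0 (\<C> n)"
    and nested: "Q \<in> \<C> n \<Longrightarrow> R \<in> \<C> m \<Longrightarrow> m \<le> n \<Longrightarrow> Q \<subseteq> R \<or> Q \<inter> R = {}"
    and measure_pos: "Q \<in> \<C> n \<Longrightarrow> 0 < measure M Q"
    and fmeasurable_top: "Q\<^sub>0 \<in> fmeasurable M"
    and A_ge_1: "1 \<le> A"
    and parent_le: "Q \<in> \<C> (Suc n) \<Longrightarrow> P \<in> \<C> n \<Longrightarrow> Q \<subseteq> P \<Longrightarrow> measure M P \<le> A * measure M Q"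
begin

lemma cube_nonempty: "Q \<in> \<C> n \<Longrightarrow> Q \<noteq> {}"
  using partition_onD3[OF partition_cubes] by blast

lemma cube_subset_top: "Q \<in> \<C> n \<Longrightarrow> Q \<subseteq> Q\<^sub>0"
  using partition_onD1[OF partition_cubes] by blast

lemma fmeasurable_cube: "Q \<in> \<C> n \<Longrightarrow> Q \<in> fmeasurable M"
  using fmeasurableI2[OF fmeasurable_top cube_subset_top] sets_cubes by blast

end

text \<open>
  The number \<open>c\<close> is a free parameter, large in terms of \<open>p\<close> and \<open>K\<close>; successive levels will have ratio
  \<open>4 * A * c\<close>, which turns the proportion \<open>A / a\<close> of the weak-type estimate into \<open>1 / (4 * c)\<close>.
  The hypothesis \<open>differentiation\<close> is all that remains of the differentiation theorem: where \<open>w\<close>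
  exceeds a level, so does the average over some cube around the point.
\<close>

locale reverse_hoelder_filtration = dyadic_filtration +
  fixes w :: "'a \<Rightarrow> real" and p K c :: real
  assumes p_gt_1: "1 < p" and K_ge_1: "1 \<le> K"
    and c_ge_1: "1 \<le> c" and c_large: "c powr (1 - p) * K powr p \<le> 1 / 4"
    and w_measurable [measurable]: "w \<in> borel_measurable M"
    and w_nonneg: "x \<in> space M \<Longrightarrow> 0 \<le> w x"
    and w_integrable: "set_integrable M Q\<^sub>0 w"
    and wp_integrable: "set_integrable M Q\<^sub>0 (\<lambda>x. w x powr p)"
    and reverse_hoelder: "Q \<in> \<C> n \<Longrightarrow> average M Q (\<lambda>x. w x powr p) \<le> (K * average M Q w) powr p"
    and differentiation:
      "AE x in M. x \<in> Q\<^sub>0 \<longrightarrow> (\<forall>l<w x. \<exists>n. \<exists>Q\<in>\<C> n. x \<in> Q \<and> l < average M Q w)"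
begin

text \<open>
  Maximality is expressed by generations: a cube is selected when no cube of a strictly smaller
  generation containing it has an average above the level.
\<close>

definition stopping_cubes :: "real \<Rightarrow> 'a set set" where
  "stopping_cubes l =
     {Q. \<exists>n. Q \<in> \<C> n \<and> l < average M Q w \<and> (\<forall>m<n. \<forall>R\<in>\<C> m. Q \<subseteq> R \<longrightarrow> average M R w \<le> l)}"

definition superlevel :: "real \<Rightarrow> 'a set" where
  "superlevel l = \<Union>(stopping_cubes l)"

lemma stopping_cubesE:
  assumes "Q \<in> stopping_cubes l"
  obtains n where "Q \<in> \<C> n" "l < average M Q w"
    "\<forall>m<n. \<forall>R\<in>\<C> m. Q \<subseteq> R \<longrightarrow> average M R w \<le> l"
  using assms unfolding stopping_cubes_def mem_Collect_eq by (elim exE conjE) (rule that)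

lemma stopping_cubes_cover:
  assumes "Q \<in> \<C> n" "l < average M Q w"
  obtains R where "R \<in> stopping_cubes l" "Q \<subseteq> R"
proof -
  define P where "P k \<longleftrightarrow> (\<exists>R\<in>\<C> k. Q \<subseteq> R \<and> l < average M R w)" for k
  have "P n" using assms by (auto simp: P_def)
  then have "P (Least P)" by (rule LeastI)
  then obtain R where R: "R \<in> \<C> (Least P)" "Q \<subseteq> R" "l < average M R w" by (auto simp: P_def)
  have "average M S w \<le> l" if "m < Least P" "S \<in> \<C> m" "R \<subseteq> S" for m S
    using not_less_Least[OF that(1)] that(2,3) R(2) by (force simp: P_def)
  with R have "R \<in> stopping_cubes l" by (auto simp: stopping_cubes_def)
  with R show ?thesis using that by blast
qed

lemma stopping_cubes_sets: "stopping_cubes l \<subseteq> sets M"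
  using sets_cubes by (auto simp: stopping_cubes_def)

lemma countable_stopping_cubes: "countable (stopping_cubes l)"
proof (rule countable_subset)
  show "stopping_cubes l \<subseteq> (\<Union>n. \<C> n)" by (auto simp: stopping_cubes_def)
  show "countable (\<Union>n. \<C> n)" by (simp add: countable_cubes)
qed

lemma superlevel_sets [measurable]: "superlevel l \<in> sets M"
  unfolding superlevel_def using stopping_cubes_sets countable_stopping_cubes by (rule sets.countable_Union[rotated])

lemma superlevel_subset_top: "superlevel l \<subseteq> Q\<^sub>0"
  using cube_subset_top by (fastforce simp: superlevel_def stopping_cubes_def)

text \<open>
  If \<open>R\<close> belonged to an earlier generation than \<open>Q\<close>, it would contain \<open>Q\<close>, and its average,
  exceeding \<open>k \<ge> l\<close>, would prevent the selection of \<open>Q\<close> at level \<open>l\<close>. For \<open>k = l\<close> this gives disjointness of the stopping cubes.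
\<close>

lemma stopping_cubes_nested:
  assumes "R \<in> stopping_cubes k" "Q \<in> stopping_cubes l" "l \<le> k" "R \<inter> Q \<noteq> {}"
  shows "R \<subseteq> Q"
proof -
  obtain m where m: "R \<in> \<C> m" "k < average M R w"
    using assms(1) by (elim stopping_cubesE) (rule that)
  obtain n where n: "Q \<in> \<C> n" "\<forall>m<n. \<forall>R\<in>\<C> m. Q \<subseteq> R \<longrightarrow> average M R w \<le> l"
    using assms(2) by (elim stopping_cubesE) (rule that)
  show ?thesis
  proof (cases "n \<le> m")
    case True
    then show ?thesis using nested[OF m(1) n(1)] assms(4) by blast
  next
    case False
    then have "Q \<subseteq> R" using nested[OF n(1) m(1)] assms(4) by auto
    then have "average M R w \<le> l" using n(2) False m(1) by (meson not_le)
    then show ?thesis using m(2) assms(3) by linarith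
  qed
qed

lemma disjoint_stopping_cubes: "disjoint (stopping_cubes l)"
  using stopping_cubes_nested[of _ l _ l] unfolding disjoint_def by (metis Int_commute order_refl subset_antisym)

lemma superlevel_antimono:
  assumes "l \<le> k"
  shows "superlevel k \<subseteq> superlevel l"
proof
  fix x assume "x \<in> superlevel k"
  then obtain R n where "x \<in> R" "R \<in> \<C> n" "k < average M R w"
    unfolding superlevel_def by (auto elim: stopping_cubesE)
  then show "x \<in> superlevel l"
    using stopping_cubes_cover[of R n l] assms unfolding superlevel_def
    by (metis Union_iff order_le_less_trans subsetD)
qed

lemma AE_superlevel:
  "AE x in M. x \<in> Q\<^sub>0 \<longrightarrow> (\<forall>l<w x. x \<in> superlevel l)"
  using differentiation
proof eventually_elim
  case (elim x)
  show ?case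
  proof (intro impI allI)
    fix l assume "x \<in> Q\<^sub>0" "l < w x"
    with elim obtain n Q where "Q \<in> \<C> n" "x \<in> Q" "l < average M Q w" by blast
    then show "x \<in> superlevel l"
      using stopping_cubes_cover[of Q n l] unfolding superlevel_def by blast
  qed
qed

lemma w_integrable_cube: "Q \<in> sets M \<Longrightarrow> Q \<subseteq> Q\<^sub>0 \<Longrightarrow> set_integrable M Q w"
  using set_integrable_subset[OF w_integrable] by blast

lemma wp_integrable_cube: "Q \<in> sets M \<Longrightarrow> Q \<subseteq> Q\<^sub>0 \<Longrightarrow> set_integrable M Q (\<lambda>x. w x powr p)"
  using set_integrable_subset[OF wp_integrable] by blast

lemma w_nonneg_cube: "Q \<in> \<C> n \<Longrightarrow> x \<in> Q \<Longrightarrow> 0 \<le> w x"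
  using sets_cubes sets.sets_into_space w_nonneg by blast

lemma cube_integral_eq: "Q \<in> \<C> n \<Longrightarrow> (LINT x:Q|M. w x) = average M Q w * measure M Q"
  using measure_pos by (simp add: average_def less_imp_neq[THEN not_sym])

lemma weight_measure_cube:
  assumes "Q \<in> \<C> n"
  shows "emeasure (density M (\<lambda>x. ennreal (w x))) Q = ennreal (average M Q w * measure M Q)"
proof -
  have Q: "Q \<in> sets M" using assms sets_cubes by blast
  show ?thesis
    unfolding cube_integral_eq[OF assms, symmetric]
    using w_nonneg_cube[OF assms] w_integrable_cube[OF Q cube_subset_top[OF assms]]
    by (intro emeasure_density_eq_set_integral w_measurable Q)
qed

text \<open>
  The top cube is not selected, since its average is at most \<open>l\<close>. So \<open>Q\<close> has a parent inside \<open>Q\<^sub>0\<close>;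
  the parent has average at most \<open>l\<close>, and its measure is at most \<open>A\<close> times that of \<open>Q\<close>.
\<close>

lemma stopping_cube_average_le:
  assumes "Q \<in> stopping_cubes l" "average M Q\<^sub>0 w \<le> l"
  shows "average M Q w \<le> A * l"
proof -
  obtain n where n: "Q \<in> \<C> n" "l < average M Q w"
    "\<forall>m<n. \<forall>R\<in>\<C> m. Q \<subseteq> R \<longrightarrow> average M R w \<le> l"
    using assms(1) by (elim stopping_cubesE) (rule that)
  obtain m where m: "n = Suc m"
    using n(1,2) assms(2) top_cube by (cases n) auto
  obtain x where "x \<in> Q" using cube_nonempty[OF n(1)] by blast
  moreover have "x \<in> \<Union>(\<C> m)"
    using \<open>x \<in> Q\<close> cube_subset_top[OF n(1)] partition_onD1[OF partition_cubes[of m]] by auto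
  ultimately obtain P where P: "P \<in> \<C> m" "Q \<subseteq> P"
    using nested[OF n(1), of _ m] m by auto
  have l0: "0 \<le> l"
  proof -
    have "0 \<le> average M Q\<^sub>0 w"
      using w_nonneg_cube[of Q\<^sub>0 0] top_cube unfolding average_def set_lebesgue_integral_def
      by (intro divide_nonneg_nonneg Bochner_Integration.integral_nonneg) (auto split: split_indicator)
    then show ?thesis using assms by simp
  qed
  have "average M Q w * measure M Q = (LINT x:Q|M. w x)"
    using cube_integral_eq[OF n(1)] by simp
  also have "\<dots> \<le> (LINT x:P|M. w x)"
    unfolding set_lebesgue_integral_def
  proof (rule integral_mono)
    show "integrable M (\<lambda>x. indicator Q x *\<^sub>R w x)"
      using w_integrable_cube[of Q] n(1) sets_cubes cube_subset_top unfolding set_integrable_def by blast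
    show "integrable M (\<lambda>x. indicator P x *\<^sub>R w x)"
      using w_integrable_cube[of P] P(1) sets_cubes cube_subset_top unfolding set_integrable_def by blast
  qed (use P w_nonneg_cube[OF P(1)] in \<open>auto split: split_indicator\<close>)
  also have "\<dots> = average M P w * measure M P"
    using cube_integral_eq[OF P(1)] .
  also have "\<dots> \<le> l * (A * measure M Q)"
  proof (rule mult_mono)
    show "average M P w \<le> l" using n(3) m P by blast
    show "measure M P \<le> A * measure M Q" using parent_le[of Q m P] n(1) m P by blast
  qed (use l0 in auto)
  finally show ?thesis
    using measure_pos[OF n(1)] mult_right_le_imp_le[of "average M Q w" "measure M Q" "A * l"]
    by (simp add: mult_ac)
qed

text \<open>
  The stopping cubes of level \<open>a l\<close> that meet \<open>Q\<close> lie in \<open>Q\<close> and are disjoint. On each of them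
  \<open>\<mu>\<close> is at most \<open>1 / (a l)\<close> times the integral of \<open>w\<close>, and these integrals add up to at most
  the integral over \<open>Q\<close>, which is at most \<open>A l \<mu>(Q)\<close>.
\<close>

lemma measure_superlevel_Int_le:
  assumes l: "0 < l" "average M Q\<^sub>0 w \<le> l" and a: "1 \<le> a" and Q: "Q \<in> stopping_cubes l"
  shows "measure M (superlevel (a * l) \<inter> Q) \<le> A / a * measure M Q"
proof -
  define F where "F = {R \<in> stopping_cubes (a * l). R \<subseteq> Q}"
  define \<nu> where "\<nu> = density M (\<lambda>x. ennreal (w x))"
  have "l \<le> a * l" using l a by simp
  then have eq: "superlevel (a * l) \<inter> Q = Q \<inter> \<Union>F"
    unfolding superlevel_def F_def using stopping_cubes_nested[OF _ Q] by blast
  obtain n where n: "Q \<in> \<C> n" using Q by (elim stopping_cubesE) (rule that)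
  have Qs: "Q \<in> sets M" using n sets_cubes by blast
  have F: "countable F" "F \<subseteq> sets M" "disjoint F"
    using countable_stopping_cubes[of "a*l"] stopping_cubes_sets[of "a*l"] disjoint_stopping_cubes[of "a*l"]
    unfolding F_def by (auto intro: countable_subset simp: disjoint_def)
  have "emeasure M (Q \<inter> \<Union>F) \<le> ennreal (1 / (a * l)) * emeasure \<nu> (\<Union>F)"
  proof (rule emeasure_Int_Union_le[OF F _ Qs])
    fix R assume R: "R \<in> F"
    obtain m where m: "R \<in> \<C> m" "a * l < average M R w"
      using R unfolding F_def by (auto elim: stopping_cubesE)
    have "emeasure M (Q \<inter> R) = ennreal (measure M R)"
      using R fmeasurable_cube[OF m(1)] by (auto simp: F_def Int_absorb1 emeasure_eq_measure2)
    also have "\<dots> \<le> ennreal (1 / (a * l) * (average M R w * measure M R))"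
    proof (rule ennreal_leI)
      have "a * l * measure M R \<le> average M R w * measure M R"
        using m(2) by (intro mult_right_mono) auto
      then show "measure M R \<le> 1 / (a * l) * (average M R w * measure M R)"
        using a l by (simp add: pos_le_divide_eq mult_ac)
    qed
    also have "\<dots> = ennreal (1 / (a * l)) * ennreal (average M R w * measure M R)"
      using a l by (intro ennreal_mult') auto
    also have "ennreal (average M R w * measure M R) = emeasure \<nu> R"
      unfolding \<nu>_def
      by (rule weight_measure_cube[OF m(1), symmetric])
    finally show "emeasure M (Q \<inter> R) \<le> ennreal (1 / (a * l)) * emeasure \<nu> R" .
  qed (simp add: \<nu>_def)
  also have "\<dots> \<le> ennreal (1 / (a * l)) * emeasure \<nu> Q"
    using Qs by (intro mult_left_mono emeasure_mono) (auto simp: F_def \<nu>_def)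
  also have "emeasure \<nu> Q = ennreal (average M Q w * measure M Q)"
    unfolding \<nu>_def
    by (rule weight_measure_cube[OF n])
  also have "\<dots> \<le> ennreal (A * l * measure M Q)"
    using stopping_cube_average_le[OF Q l(2)] by (intro ennreal_leI mult_right_mono) auto
  also have "ennreal (1 / (a * l)) * ennreal (A * l * measure M Q) = ennreal (A / a * measure M Q)"
    using l a by (subst ennreal_mult'[symmetric]) simp_all
  finally have "emeasure M (Q \<inter> \<Union>F) \<le> ennreal (A / a * measure M Q)"
    by (simp add: mult_left_mono)
  then show ?thesis
    using A_ge_1 a unfolding eq measure_def[of M "Q \<inter> _"] by (intro enn2real_leI) auto
qed

section \<open>Decay of the power integral over superlevel sets\<close>

abbreviation power_measure :: "'a measure" where
  "power_measure \<equiv> density M (\<lambda>x. ennreal (w x powr p))"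

abbreviation decay :: real where
  "decay \<equiv> 1 - (4 * K) powr (-p)"

lemma decay_bounds: "0 < decay" "decay < 1"
proof -
  have "(4 * K) powr (-p) < (4 * K) powr 0"
    using K_ge_1 p_gt_1 by (intro powr_less_mono) auto
  then show "0 < decay" using K_ge_1 by simp
  show "decay < 1" using K_ge_1 by simp
qed

text \<open>
  For \<open>a = 4 A c\<close> the weak-type estimate leaves \<open>\<Omega>(a l)\<close> at most the proportion \<open>1 / (4 c)\<close> of
  every stopping cube of level \<open>l\<close>, which is what non-concentration of \<open>w\<^sup>p\<close> requires.
\<close>

lemma power_measure_superlevel_decay:
  assumes l: "0 < l" "average M Q\<^sub>0 w \<le> l"
  shows "emeasure power_measure (superlevel (4 * A * c * l))
    \<le> ennreal decay * emeasure power_measure (superlevel l)"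
proof -
  define a where "a = 4 * A * c"
  have a: "1 \<le> a"
    using mult_mono[of 1 "4 * A" 1 c] A_ge_1 c_ge_1 by (simp add: a_def)
  have "emeasure power_measure (superlevel (a * l) \<inter> \<Union>(stopping_cubes l))
    \<le> ennreal decay * emeasure power_measure (\<Union>(stopping_cubes l))"
  proof (rule emeasure_Int_Union_le)
    fix Q assume Q: "Q \<in> stopping_cubes l"
    obtain n where n: "Q \<in> \<C> n" "l < average M Q w" using Q by (elim stopping_cubesE) (rule that)
    have Qs: "Q \<in> sets M" "Q \<subseteq> Q\<^sub>0" using n sets_cubes cube_subset_top by blast+
    let ?E = "superlevel (a * l) \<inter> Q"
    have "emeasure power_measure ?E = ennreal (LINT x:?E|M. w x powr p)"
      using Qs wp_integrable_cube[of ?E] by (intro emeasure_density_eq_set_integral) auto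
    also have "(LINT x:?E|M. w x powr p) \<le> decay * (LINT x:Q|M. w x powr p)"
    proof (rule set_integral_powr_le_of_small_measure[OF p_gt_1 K_ge_1 _ c_large])
      show "measure M ?E \<le> measure M Q / (4 * c)"
        using measure_superlevel_Int_le[OF l a Q] A_ge_1 by (simp add: a_def)
    qed (use c_ge_1 Qs n l fmeasurable_cube w_nonneg_cube w_integrable_cube wp_integrable_cube
           reverse_hoelder[OF n(1)] in auto)
    also have "ennreal \<dots> = ennreal decay * ennreal (LINT x:Q|M. w x powr p)"
      using decay_bounds by (intro ennreal_mult') auto
    also have "ennreal (LINT x:Q|M. w x powr p) = emeasure power_measure Q"
      using Qs wp_integrable_cube[of Q] by (intro emeasure_density_eq_set_integral[symmetric]) auto
    finally show "emeasure power_measure ?E \<le> ennreal decay * emeasure power_measure Q"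
      by (simp add: ennreal_leI)
  qed (use countable_stopping_cubes stopping_cubes_sets disjoint_stopping_cubes in auto)
  moreover have "superlevel (a * l) \<subseteq> superlevel l"
    using a l by (intro superlevel_antimono) auto
  ultimately show ?thesis
    by (simp add: a_def superlevel_def[of l, symmetric] Int_absorb2)
qed

lemma power_measure_superlevel_geometric:
  assumes l: "0 < l" "average M Q\<^sub>0 w \<le> l"
  shows "emeasure power_measure (superlevel ((4 * A * c) ^ k * l))
    \<le> ennreal (decay ^ k) * emeasure power_measure Q\<^sub>0"
proof (induction k)
  case 0
  show ?case
    using superlevel_subset_top fmeasurable_top by (auto intro!: emeasure_mono)
next
  case (Suc k)
  let ?l = "(4 * A * c) ^ k * l"
  have "1 \<le> 4 * A * c"
    using mult_mono[of 1 "4 * A" 1 c] A_ge_1 c_ge_1 by simp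
  then have "1 \<le> (4 * A * c) ^ k" by (rule one_le_power)
  then have l': "l \<le> ?l" using l by simp
  have "emeasure power_measure (superlevel ((4 * A * c) ^ Suc k * l))
      = emeasure power_measure (superlevel (4 * A * c * ?l))"
    by (simp add: mult.assoc)
  also have "\<dots> \<le> ennreal decay * emeasure power_measure (superlevel ?l)"
    using l l' by (intro power_measure_superlevel_decay) linarith+
  also have "\<dots> \<le> ennreal decay * (ennreal (decay ^ k) * emeasure power_measure Q\<^sub>0)"
    by (intro mult_left_mono Suc.IH) simp
  also have "\<dots> = ennreal (decay ^ Suc k) * emeasure power_measure Q\<^sub>0"
    using decay_bounds by (simp add: ennreal_mult' mult.assoc)
  finally show ?case .
qed

section \<open>Integrability of a higher power\<close>

text \<open>
  Put \<open>a = 4 A c\<close>. If \<open>w x\<close> lies in \<open>(a\<^sup>k l, a\<^bsup>k+1\<^esup> l]\<close>, the single summand of index \<open>k\<close> is already large enough; the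
  summand \<open>1\<close> is there for \<open>w x \<le> l\<close>.
\<close>

lemma w_powr_le_superlevel_series:
  assumes l: "0 < l" and \<epsilon>: "0 < \<epsilon>" and x: "x \<in> Q\<^sub>0"
    and sup: "\<forall>l<w x. x \<in> superlevel l"
  defines "b \<equiv> (4 * A * c) powr \<epsilon>"
  shows "ennreal (w x powr \<epsilon>) \<le> ennreal (l powr \<epsilon>) *
    (1 + (\<Sum>k. ennreal (b ^ Suc k) * indicator (superlevel ((4 * A * c) ^ k * l)) x))"
    (is "_ \<le> _ * (1 + ?S)")
proof (cases "w x \<le> l")
  case True
  have "0 \<le> w x" using x fmeasurable_top w_nonneg sets.sets_into_space by (auto simp: fmeasurable_def)
  with True have "ennreal (w x powr \<epsilon>) \<le> ennreal (l powr \<epsilon>) * 1"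
    using \<epsilon> by (simp add: ennreal_leI powr_mono2)
  also have "\<dots> \<le> ennreal (l powr \<epsilon>) * (1 + ?S)"
    by (intro mult_left_mono) auto
  finally show ?thesis .
next
  case False
  define a where "a = 4 * A * c"
  have a: "4 \<le> a"
    using mult_mono[of 1 A 1 c] A_ge_1 c_ge_1 by (simp add: a_def)
  define N where "N = (LEAST n. w x \<le> a ^ n * l)"
  obtain n where "w x / l < a ^ n"
    using real_arch_pow[of a "w x / l"] a by auto
  then have "w x \<le> a ^ n * l" using l by (simp add: pos_divide_less_eq)
  then have N: "w x \<le> a ^ N * l" unfolding N_def by (rule LeastI)
  then obtain k where k: "N = Suc k" using False by (cases N) auto
  have "\<not> w x \<le> a ^ k * l"
    using not_less_Least[of k "\<lambda>n. w x \<le> a ^ n * l"] k by (simp add: N_def)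
  then have mem: "x \<in> superlevel (a ^ k * l)" using sup by simp
  have "w x powr \<epsilon> \<le> (a ^ Suc k * l) powr \<epsilon>"
    using N k False l \<epsilon> by (intro powr_mono2) auto
  also have "\<dots> = l powr \<epsilon> * b ^ Suc k"
  proof -
    have "(a ^ Suc k) powr \<epsilon> = (a powr \<epsilon>) ^ Suc k"
      using a by (simp add: powr_powr powr_power mult.commute del: power_Suc flip: powr_realpow)
    then show ?thesis
      unfolding b_def a_def[symmetric] powr_mult by (simp only: mult.commute)
  qed
  finally have "ennreal (w x powr \<epsilon>) \<le> ennreal (l powr \<epsilon>) * ennreal (b ^ Suc k)"
    by (metis ennreal_leI ennreal_mult' powr_ge_zero)
  also have "ennreal (b ^ Suc k) = (\<Sum>j\<in>{k}. ennreal (b ^ Suc j) * indicator (superlevel (a ^ j * l)) x)"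
    using mem by simp
  also have "\<dots> \<le> ?S"
    unfolding a_def by (intro sum_le_suminf) auto
  also have "?S \<le> 1 + ?S" by (simp add: add_increasing)
  finally show ?thesis by (simp add: mult_left_mono)
qed

lemma higher_power_nn_integral_le:
  assumes l: "0 < l" "average M Q\<^sub>0 w \<le> l" and \<epsilon>: "0 < \<epsilon>"
    and conv: "(4 * A * c) powr \<epsilon> * decay < 1"
  defines "b \<equiv> (4 * A * c) powr \<epsilon>"
  shows "(\<integral>\<^sup>+x. ennreal (w x powr (p + \<epsilon>)) * indicator Q\<^sub>0 x \<partial>M)
    \<le> ennreal (l powr \<epsilon> * (1 + b / (1 - b * decay)) * (LINT x:Q\<^sub>0|M. w x powr p))"
proof -
  define \<Omega> where "\<Omega> k = superlevel ((4 * A * c) ^ k * l)" for k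
  have [measurable]: "\<Omega> k \<in> sets M" for k by (simp add: \<Omega>_def)
  have [measurable]: "Q\<^sub>0 \<in> sets M" using fmeasurable_top by auto
  have b0: "0 < b" using A_ge_1 c_ge_1 by (simp add: b_def)
  let ?P = "emeasure power_measure Q\<^sub>0"
  have "(\<integral>\<^sup>+x. ennreal (w x powr (p + \<epsilon>)) * indicator Q\<^sub>0 x \<partial>M)
     \<le> (\<integral>\<^sup>+x. ennreal (w x powr p) * (ennreal (l powr \<epsilon>) *
           (indicator Q\<^sub>0 x + (\<Sum>k. ennreal (b ^ Suc k) * indicator (\<Omega> k) x))) \<partial>M)"
  proof (rule nn_integral_mono_AE)
    show "AE x in M. ennreal (w x powr (p + \<epsilon>)) * indicator Q\<^sub>0 x \<le> ennreal (w x powr p) *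
        (ennreal (l powr \<epsilon>) * (indicator Q\<^sub>0 x + (\<Sum>k. ennreal (b ^ Suc k) * indicator (\<Omega> k) x)))"
      using AE_superlevel
    proof eventually_elim
      case (elim x)
      show ?case
      proof (cases "x \<in> Q\<^sub>0")
        case True
        then have "ennreal (w x powr p) * ennreal (w x powr \<epsilon>) \<le> ennreal (w x powr p) *
          (ennreal (l powr \<epsilon>) * (1 + (\<Sum>k. ennreal (b ^ Suc k) * indicator (\<Omega> k) x)))"
          using w_powr_le_superlevel_series[OF l(1) \<epsilon> True] elim
          unfolding b_def \<Omega>_def by (intro mult_left_mono) auto
        then show ?thesis
          using True by (simp add: powr_add ennreal_mult')
      qed simp
    qed
  qed
  also have "\<dots> = (\<integral>\<^sup>+x. ennreal (l powr \<epsilon>) *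
           (indicator Q\<^sub>0 x + (\<Sum>k. ennreal (b ^ Suc k) * indicator (\<Omega> k) x)) \<partial>power_measure)"
    by (subst nn_integral_density) auto
  also have "\<dots> = ennreal (l powr \<epsilon>) * (?P + (\<Sum>k. ennreal (b ^ Suc k) * emeasure power_measure (\<Omega> k)))"
    by (simp add: nn_integral_cmult nn_integral_add nn_integral_suminf del: power_Suc)
  also have "\<dots> \<le> ennreal (l powr \<epsilon>) * (?P + (\<Sum>k. ennreal (b ^ Suc k) * (ennreal (decay ^ k) * ?P)))"
    unfolding \<Omega>_def
    by (intro mult_left_mono add_left_mono suminf_le power_measure_superlevel_geometric l) auto
  also have "(\<Sum>k. ennreal (b ^ Suc k) * (ennreal (decay ^ k) * ?P)) = (\<Sum>k. ennreal (b * (b * decay) ^ k) * ?P)"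
  proof (rule suminf_cong)
    fix k
    have "b * (b * decay) ^ k = b ^ Suc k * decay ^ k"
      by (simp add: power_mult_distrib)
    then have "ennreal (b * (b * decay) ^ k) = ennreal (b ^ Suc k) * ennreal (decay ^ k)"
      using b0 by (simp only: ennreal_mult' zero_le_power less_imp_le)
    then show "ennreal (b ^ Suc k) * (ennreal (decay ^ k) * ?P) = ennreal (b * (b * decay) ^ k) * ?P"
      by (simp only: mult.assoc)
  qed
  also have "\<dots> = (\<Sum>k. ennreal (b * (b * decay) ^ k)) * ?P"
    by simp
  also have "(\<Sum>k. ennreal (b * (b * decay) ^ k)) = ennreal (b / (1 - b * decay))"
  proof (rule suminf_ennreal_eq)
    show "(\<lambda>k. b * (b * decay) ^ k) sums (b / (1 - b * decay))"
      using geometric_sums[of "b * decay"] b0 decay_bounds conv sums_mult[of _ _ b]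
      by (fastforce simp: b_def[symmetric] abs_mult)
  qed (use b0 decay_bounds in auto)
  also have "?P = ennreal (LINT x:Q\<^sub>0|M. w x powr p)"
    using wp_integrable by (intro emeasure_density_eq_set_integral) auto
  also have "ennreal (l powr \<epsilon>) * (ennreal (LINT x:Q\<^sub>0|M. w x powr p) + ennreal (b / (1 - b * decay)) * ennreal (LINT x:Q\<^sub>0|M. w x powr p))
     = ennreal (l powr \<epsilon> * (1 + b / (1 - b * decay)) * (LINT x:Q\<^sub>0|M. w x powr p))"
  proof -
    have "0 \<le> (LINT x:Q\<^sub>0|M. w x powr p)"
      unfolding set_lebesgue_integral_def by (intro Bochner_Integration.integral_nonneg) simp
    then have "ennreal (LINT x:Q\<^sub>0|M. w x powr p) + ennreal (b / (1 - b * decay)) * ennreal (LINT x:Q\<^sub>0|M. w x powr p)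
       = ennreal ((1 + b / (1 - b * decay)) * (LINT x:Q\<^sub>0|M. w x powr p))"
      using b0 conv unfolding b_def[symmetric] distrib_right mult_1_left
      by (subst ennreal_mult'[symmetric]) (auto intro!: ennreal_plus[symmetric])
    then show ?thesis
      by (simp only: ennreal_mult' powr_ge_zero mult.assoc)
  qed
  finally show ?thesis by (simp add: mult_left_mono)
qed

text \<open>
  The estimate is available for every level \<open>l\<close> above the average \<open>m\<close> of \<open>w\<close>, and \<open>l\<close> then decreases
  to \<open>m\<close>. This includes the case \<open>m = 0\<close>, where \<open>m\<close> itself is not an admissible level.
\<close>

lemma
  assumes \<epsilon>: "0 < \<epsilon>" and conv: "(4 * A * c) powr \<epsilon> * decay < 1"
  defines "b \<equiv> (4 * A * c) powr \<epsilon>"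
  shows higher_power_integrable: "set_integrable M Q\<^sub>0 (\<lambda>x. w x powr (p + \<epsilon>))"
    and higher_power_average_le: "average M Q\<^sub>0 (\<lambda>x. w x powr (p + \<epsilon>)) powr (1 / (p + \<epsilon>))
      \<le> ((1 + b / (1 - b * decay)) * K powr p) powr (1 / (p + \<epsilon>)) * average M Q\<^sub>0 w"
proof -
  define m where "m = average M Q\<^sub>0 w"
  define B where "B = 1 + b / (1 - b * decay)"
  have B0: "0 \<le> B" using conv by (simp add: B_def b_def)
  have top: "Q\<^sub>0 \<in> \<C> 0" using top_cube by simp
  have [measurable]: "Q\<^sub>0 \<in> sets M" using fmeasurable_top by auto
  have \<mu>: "0 < measure M Q\<^sub>0" using measure_pos[OF top] .
  have m0: "0 \<le> m"
    using w_nonneg_cube[OF top] unfolding m_def average_def set_lebesgue_integral_def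
    by (intro divide_nonneg_nonneg Bochner_Integration.integral_nonneg) (auto split: split_indicator)
  have ind: "(\<integral>\<^sup>+x. ennreal (indicator Q\<^sub>0 x *\<^sub>R w x powr (p + \<epsilon>)) \<partial>M)
      = (\<integral>\<^sup>+x. ennreal (w x powr (p + \<epsilon>)) * indicator Q\<^sub>0 x \<partial>M)"
    by (intro nn_integral_cong) (simp split: split_indicator)
  have le: "(\<integral>\<^sup>+x. ennreal (indicator Q\<^sub>0 x *\<^sub>R w x powr (p + \<epsilon>)) \<partial>M)
      \<le> ennreal (l powr \<epsilon> * B * (LINT x:Q\<^sub>0|M. w x powr p))" if "m < l" for l
    unfolding ind B_def b_def using that m0 \<epsilon> conv
    by (intro higher_power_nn_integral_le) (auto simp: m_def)
  show int: "set_integrable M Q\<^sub>0 (\<lambda>x. w x powr (p + \<epsilon>))"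
    unfolding set_integrable_def
    using le[of "m + 1"] by (intro integrableI_nonneg) (auto intro: le_less_trans)
  have "average M Q\<^sub>0 (\<lambda>x. w x powr (p + \<epsilon>)) powr (1 / (p + \<epsilon>)) \<le> (B * K powr p) powr (1 / (p + \<epsilon>)) * l"
    if l: "m < l" for l
  proof -
    have "ennreal (LINT x:Q\<^sub>0|M. w x powr (p + \<epsilon>)) \<le> ennreal (l powr \<epsilon> * B * (LINT x:Q\<^sub>0|M. w x powr p))"
      using le[OF l] int unfolding set_lebesgue_integral_def set_integrable_def
      by (subst nn_integral_eq_integral[symmetric]) auto
    moreover have "0 \<le> (LINT x:Q\<^sub>0|M. w x powr p)"
      unfolding set_lebesgue_integral_def by (intro Bochner_Integration.integral_nonneg) simp
    ultimately have "(LINT x:Q\<^sub>0|M. w x powr (p + \<epsilon>)) \<le> l powr \<epsilon> * B * (LINT x:Q\<^sub>0|M. w x powr p)"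
      using B0 by (simp add: ennreal_le_iff)
    then have "average M Q\<^sub>0 (\<lambda>x. w x powr (p + \<epsilon>)) \<le> l powr \<epsilon> * B * average M Q\<^sub>0 (\<lambda>x. w x powr p)"
      using \<mu> by (simp add: average_def divide_right_mono)
    also have "\<dots> \<le> l powr \<epsilon> * B * (K * l) powr p"
    proof (intro mult_left_mono)
      have "(K * m) powr p \<le> (K * l) powr p"
        using l m0 K_ge_1 p_gt_1 by (intro powr_mono2 mult_left_mono) auto
      then show "average M Q\<^sub>0 (\<lambda>x. w x powr p) \<le> (K * l) powr p"
        using reverse_hoelder[OF top] by (simp add: m_def)
    qed (use B0 in auto)
    also have "\<dots> = (B * K powr p) * l powr (p + \<epsilon>)"
      using l m0 K_ge_1 by (simp add: powr_mult powr_add)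
    finally have "average M Q\<^sub>0 (\<lambda>x. w x powr (p + \<epsilon>)) powr (1 / (p + \<epsilon>))
        \<le> ((B * K powr p) * l powr (p + \<epsilon>)) powr (1 / (p + \<epsilon>))"
      using p_gt_1 \<epsilon> unfolding average_def set_lebesgue_integral_def
      by (intro powr_mono2) (auto intro!: divide_nonneg_nonneg Bochner_Integration.integral_nonneg)
    also have "\<dots> = (B * K powr p) powr (1 / (p + \<epsilon>)) * l"
      using B0 l m0 p_gt_1 \<epsilon> by (simp add: powr_mult powr_powr)
    finally show ?thesis .
  qed
  moreover have "((\<lambda>l. (B * K powr p) powr (1 / (p + \<epsilon>)) * l) \<longlongrightarrow> (B * K powr p) powr (1 / (p + \<epsilon>)) * m) (at_right m)"
    by (intro tendsto_intros)
  ultimately show "average M Q\<^sub>0 (\<lambda>x. w x powr (p + \<epsilon>)) powr (1 / (p + \<epsilon>))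
      \<le> ((1 + b / (1 - b * decay)) * K powr p) powr (1 / (p + \<epsilon>)) * average M Q\<^sub>0 w"
    unfolding B_def[symmetric] m_def[symmetric]
    by (intro tendsto_lowerbound[OF _ _ trivial_limit_at_right_real]) (auto simp: eventually_at_filter)
qed

end

section \<open>Cubes in a space of homogeneous type\<close>

lemma qball_iterated_doubling:
  assumes "homogeneous_type_space M \<rho> \<kappa>\<^sub>0 \<kappa>\<^sub>1" "z \<in> space M" "0 < r"
  shows "emeasure M (qball (space M) \<rho> z (2 ^ n * r)) \<le> ennreal (\<kappa>\<^sub>1 ^ n) * emeasure M (qball (space M) \<rho> z r)"
proof (induction n)
  case (Suc n)
  have \<kappa>: "0 < \<kappa>\<^sub>1" using assms by (simp add: homogeneous_type_space_def)
  have "emeasure M (qball (space M) \<rho> z (2 ^ Suc n * r)) = emeasure M (qball (space M) \<rho> z (2 * (2 ^ n * r)))"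
    by (simp add: mult.assoc)
  also have "\<dots> \<le> ennreal \<kappa>\<^sub>1 * emeasure M (qball (space M) \<rho> z (2 ^ n * r))"
    using assms unfolding homogeneous_type_space_def by (meson mult_pos_pos zero_less_numeral zero_less_power)
  also have "\<dots> \<le> ennreal \<kappa>\<^sub>1 * (ennreal (\<kappa>\<^sub>1 ^ n) * emeasure M (qball (space M) \<rho> z r))"
    by (intro mult_left_mono Suc.IH) simp
  also have "\<dots> = ennreal (\<kappa>\<^sub>1 ^ Suc n) * emeasure M (qball (space M) \<rho> z r)"
    using \<kappa> by (simp add: ennreal_mult' mult.assoc)
  finally show ?case .
qed simp

lemma lattice_cube:
  assumes "dyadic_lattice M \<rho> \<D> r\<^sub>0 R\<^sub>0 \<delta>" "Q \<in> \<D> k"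
  shows "\<exists>z\<in>Q. qball (space M) \<rho> z (r\<^sub>0 * \<delta> powi k) \<subseteq> Q \<and> Q \<subseteq> qball (space M) \<rho> z (R\<^sub>0 * \<delta> powi k)"
  using assms(1)[unfolded dyadic_lattice_def] assms(2) by (elim conjE) simp

lemma lattice_cube_measure:
  assumes "homogeneous_type_space M \<rho> \<kappa>\<^sub>0 \<kappa>\<^sub>1" "dyadic_lattice M \<rho> \<D> r\<^sub>0 R\<^sub>0 \<delta>" "Q \<in> \<D> k"
  shows "Q \<in> fmeasurable M" "0 < measure M Q"
proof -
  have Q: "Q \<in> sets M" using assms by (auto simp: dyadic_lattice_def)
  obtain z where z: "z \<in> Q" "qball (space M) \<rho> z (r\<^sub>0 * \<delta> powi k) \<subseteq> Q" "Q \<subseteq> qball (space M) \<rho> z (R\<^sub>0 * \<delta> powi k)"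
    using lattice_cube[OF assms(2,3)] by metis
  have zM: "z \<in> space M" using Q z sets.sets_into_space by blast
  have r: "0 < r\<^sub>0 * \<delta> powi k" "0 < R\<^sub>0 * \<delta> powi k"
    using assms(2) by (auto simp: dyadic_lattice_def)
  have "emeasure M Q \<le> emeasure M (qball (space M) \<rho> z (R\<^sub>0 * \<delta> powi k))"
    using assms(1) z zM r by (intro emeasure_mono) (auto simp: homogeneous_type_space_def)
  also have "\<dots> < \<infinity>" using assms(1) zM r by (auto simp: homogeneous_type_space_def)
  finally show f: "Q \<in> fmeasurable M" using Q by (auto simp: fmeasurable_def)
  have "0 < emeasure M (qball (space M) \<rho> z (r\<^sub>0 * \<delta> powi k))"
    using assms(1) zM r by (auto simp: homogeneous_type_space_def)
  also have "\<dots> \<le> emeasure M Q" using z Q by (intro emeasure_mono)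
  finally show "0 < measure M Q"
    using f by (simp add: emeasure_eq_measure2)
qed

text \<open>
  By the quasi-triangle inequality \<open>P\<close> is contained in the ball of radius \<open>2 \<kappa>\<^sub>0 R\<^sub>0 \<delta>\<^sup>k\<close> about the
  centre of \<open>Q\<close>. After \<open>N\<close> halvings that radius is at most \<open>r\<^sub>0 \<delta>\<^bsup>k+1\<^esup>\<close>, for which the ball lies
  in \<open>Q\<close>.
\<close>

lemma parent_cube_measure_le:
  assumes X: "homogeneous_type_space M \<rho> \<kappa>\<^sub>0 \<kappa>\<^sub>1" and D: "dyadic_lattice M \<rho> \<D> r\<^sub>0 R\<^sub>0 \<delta>"
    and Q: "Q \<in> \<D> (k + 1)" and P: "P \<in> \<D> k" and sub: "Q \<subseteq> P"
    and N: "2 * \<kappa>\<^sub>0 * R\<^sub>0 \<le> 2 ^ N * (r\<^sub>0 * \<delta>)"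
  shows "measure M P \<le> \<kappa>\<^sub>1 ^ N * measure M Q"
proof -
  let ?B = "qball (space M) \<rho>"
  have \<delta>: "0 < \<delta>" "0 < r\<^sub>0" using D by (auto simp: dyadic_lattice_def)
  have \<kappa>: "0 < \<kappa>\<^sub>0" "0 < \<kappa>\<^sub>1" using X by (auto simp: homogeneous_type_space_def quasi_metric_def)
  have sets: "Q \<in> sets M" "P \<in> sets M" using D Q P by (auto simp: dyadic_lattice_def)
  obtain z where z: "z \<in> Q" "?B z (r\<^sub>0 * \<delta> powi (k + 1)) \<subseteq> Q"
    using lattice_cube[OF D Q] by metis
  obtain y where y: "y \<in> P" "P \<subseteq> ?B y (R\<^sub>0 * \<delta> powi k)"
    using lattice_cube[OF D P] by metis
  have spc: "z \<in> space M" "y \<in> space M"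
    using z y sets sets.sets_into_space by blast+
  define r where "r = r\<^sub>0 * \<delta> powi (k + 1)"
  have r: "0 < r" using \<delta> by (simp add: r_def)
  have "P \<subseteq> ?B z (2 ^ N * r)"
  proof
    fix x assume x: "x \<in> P"
    have xM: "x \<in> space M" using x sets sets.sets_into_space by blast
    have "\<rho> y x < R\<^sub>0 * \<delta> powi k" using x y by (auto simp: qball_def)
    moreover have "\<rho> y z < R\<^sub>0 * \<delta> powi k" using z y sub by (auto simp: qball_def)
    moreover have "\<rho> z y = \<rho> y z" "\<rho> z x \<le> \<kappa>\<^sub>0 * (\<rho> z y + \<rho> y x)"
      using X spc xM by (auto simp: homogeneous_type_space_def quasi_metric_def)
    ultimately have "\<rho> z x < \<kappa>\<^sub>0 * (2 * (R\<^sub>0 * \<delta> powi k))"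
      using \<kappa>(1) by (smt (verit) mult_less_cancel_left_pos)
    also have "\<dots> = (2 * \<kappa>\<^sub>0 * R\<^sub>0) * \<delta> powi k" by simp
    also have "\<dots> \<le> (2 ^ N * (r\<^sub>0 * \<delta>)) * \<delta> powi k"
      using N \<delta> by (intro mult_right_mono) auto
    also have "\<dots> = 2 ^ N * r"
      using \<delta> by (simp add: r_def power_int_add mult_ac)
    finally show "x \<in> ?B z (2 ^ N * r)" using xM by (simp add: qball_def)
  qed
  then have "emeasure M P \<le> emeasure M (?B z (2 ^ N * r))"
    using X spc r by (intro emeasure_mono) (auto simp: homogeneous_type_space_def)
  also have "\<dots> \<le> ennreal (\<kappa>\<^sub>1 ^ N) * emeasure M (?B z r)"
    using X spc(1) r by (rule qball_iterated_doubling)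
  also have "\<dots> \<le> ennreal (\<kappa>\<^sub>1 ^ N) * emeasure M Q"
    using z sets unfolding r_def by (intro mult_left_mono emeasure_mono) auto
  also have "\<dots> = ennreal (\<kappa>\<^sub>1 ^ N * measure M Q)"
    using lattice_cube_measure(1)[OF X D Q] \<kappa> by (simp add: emeasure_eq_measure2 ennreal_mult')
  finally show ?thesis
    using lattice_cube_measure(1)[OF X D P] \<kappa> by (simp add: emeasure_eq_measure2 ennreal_le_iff)
qed

text \<open>
  Local integrability gives measurability only on balls; the balls of radius \<open>n\<close> about one point
  exhaust the space.
\<close>

lemma locally_integrable_borel_measurable:
  assumes "homogeneous_type_space M \<rho> \<kappa>\<^sub>0 \<kappa>\<^sub>1" "locally_integrable M \<rho> f"
  shows "f \<in> borel_measurable M"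
proof (cases "space M = {}")
  case True
  then show ?thesis by (simp add: measurable_def)
next
  case False
  then obtain z where z: "z \<in> space M" by blast
  show ?thesis
  proof (rule borel_measurable_LIMSEQ_metric)
    fix n
    have "set_integrable M (qball (space M) \<rho> z (real (Suc n))) f"
      using assms(2) z unfolding locally_integrable_def by simp
    then show "(\<lambda>x. indicator (qball (space M) \<rho> z (real (Suc n))) x *\<^sub>R f x) \<in> borel_measurable M"
      unfolding set_integrable_def by (rule borel_measurable_integrable)
  next
    fix x assume x: "x \<in> space M"
    obtain N where N: "\<rho> z x < real N" using reals_Archimedean2 by blast
    have "eventually (\<lambda>n. indicator (qball (space M) \<rho> z (real (Suc n))) x *\<^sub>R f x = f x) sequentially"
      using eventually_ge_at_top[of N] by eventually_elim (use N x in \<open>auto simp: qball_def indicator_def\<close>)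
    then show "(\<lambda>n. indicator (qball (space M) \<rho> z (real (Suc n))) x *\<^sub>R f x) \<longlonglongrightarrow> f x"
      by (rule tendsto_eventually)
  qed
qed

lemma cube_at_eqI:
  assumes "partition_on X (\<D> k)" "Q \<in> \<D> k" "x \<in> Q"
  shows "cube_at \<D> k x = Q"
  unfolding cube_at_def
  using assms partition_onD2[OF assms(1)] by (intro the_equality) (auto simp: disjoint_def)

lemma reverse_hoelder_bound_mono:
  assumes "reverse_hoelder_bound M \<D> q w C" "C \<le> C'"
    and "\<And>k Q. Q \<in> \<D> k \<Longrightarrow> 0 \<le> average M Q w"
  shows "reverse_hoelder_bound M \<D> q w C'"
  unfolding reverse_hoelder_bound_def
proof (intro conjI allI ballI)
  show "0 \<le> C'" using assms(1,2) by (simp add: reverse_hoelder_bound_def)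
  fix k Q assume Q: "Q \<in> \<D> k"
  show "set_integrable M Q (\<lambda>x. w x powr q)" using assms(1) Q by (auto simp: reverse_hoelder_bound_def)
  have "average M Q (\<lambda>x. w x powr q) powr (1 / q) \<le> C * average M Q w"
    using assms(1) Q by (auto simp: reverse_hoelder_bound_def)
  also have "\<dots> \<le> C' * average M Q w" using assms(2,3) Q by (intro mult_right_mono)
  finally show "average M Q (\<lambda>x. w x powr q) powr (1 / q) \<le> C' * average M Q w" .
qed

section \<open>Self-improvement of dyadic reverse Hoelder classes\<close>

text \<open>
  The maximum gives \<open>1 \<le> A\<close> at once, instead of through \<open>1 \<le> \<kappa>\<^sub>1\<close>, which follows from the
  monotonicity of the measure on balls as soon as the space is nonempty.
\<close>

lemma subcubes_reverse_hoelder_filtration: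
  assumes X: "homogeneous_type_space M \<rho> \<kappa>\<^sub>0 \<kappa>\<^sub>1" and D: "dyadic_lattice M \<rho> \<D> r\<^sub>0 R\<^sub>0 \<delta>"
    and L: "lebesgue_differentiation M \<rho> \<D>" and w: "weight M \<rho> w"
    and RH: "reverse_hoelder_bound M \<D> p w K"
    and Q\<^sub>0: "Q\<^sub>0 \<in> \<D> k"
    and N: "2 * \<kappa>\<^sub>0 * R\<^sub>0 \<le> 2 ^ N * (r\<^sub>0 * \<delta>)"
    and pKc: "1 < p" "1 \<le> K" "1 \<le> c" "c powr (1 - p) * K powr p \<le> 1 / 4"
  shows "reverse_hoelder_filtration M Q\<^sub>0 (\<lambda>n. {Q \<in> \<D> (k + int n). Q \<subseteq> Q\<^sub>0}) (max 1 (\<kappa>\<^sub>1 ^ N)) w p K c"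
proof -
  let ?C = "\<lambda>n. {Q \<in> \<D> (k + int n). Q \<subseteq> Q\<^sub>0}"
  have part: "partition_on (space M) (\<D> j)" and cnt: "countable (\<D> j)" and sets: "\<D> j \<subseteq> sets M" for j
    using D by (auto simp: dyadic_lattice_def)
  have nest: "Q \<subseteq> R \<or> Q \<inter> R = {}" if "Q \<in> \<D> i" "R \<in> \<D> j" "j \<le> i" for Q R i j
    using D[unfolded dyadic_lattice_def] that by (elim conjE) simp
  have ne: "Q \<noteq> {}" if "Q \<in> \<D> j" for Q j
    using partition_onD3[OF part] that by blast
  have sub: "Q \<subseteq> Q\<^sub>0" if "Q \<in> \<D> (k + int n)" "x \<in> Q" "x \<in> Q\<^sub>0" for Q x n
    using nest[OF that(1) Q\<^sub>0] that by auto
  have Q\<^sub>0s: "Q\<^sub>0 \<subseteq> space M" using Q\<^sub>0 sets sets.sets_into_space by blast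
  have cover: "\<exists>Q\<in>?C n. x \<in> Q" if "x \<in> Q\<^sub>0" for x n
  proof -
    have "x \<in> \<Union>(\<D> (k + int n))"
      using partition_onD1[OF part[of "k + int n"]] that Q\<^sub>0s by auto
    then show ?thesis using sub that by blast
  qed
  have loc: "locally_integrable M \<rho> w" and w0: "\<And>x. x \<in> space M \<Longrightarrow> 0 \<le> w x"
    using w by (auto simp: weight_def)
  show ?thesis
  proof
    show "?C 0 = {Q\<^sub>0}"
    proof (intro equalityI subsetI)
      fix Q assume "Q \<in> ?C 0"
      then have Q: "Q \<in> \<D> k" "Q \<subseteq> Q\<^sub>0" by auto
      then show "Q \<in> {Q\<^sub>0}"
        using nest[OF Q\<^sub>0 Q(1)] ne[OF Q(1)] by blast
    qed (use Q\<^sub>0 in auto)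
    show "countable (?C n)" for n using cnt by (rule countable_subset[rotated]) auto
    show "?C n \<subseteq> sets M" for n using sets by blast
    show "partition_on Q\<^sub>0 (?C n)" for n
      using cover[of _ n] ne part[of "k + int n"]
      by (intro partition_onI) (auto simp: partition_on_def pairwise_def)
    show "Q \<subseteq> R \<or> Q \<inter> R = {}" if "Q \<in> ?C n" "R \<in> ?C m" "m \<le> n" for Q R n m
      using nest[of Q "k + int n" R "k + int m"] that by simp
    show "0 < measure M Q" if "Q \<in> ?C n" for Q n
      using lattice_cube_measure(2)[OF X D] that by blast
    show "Q\<^sub>0 \<in> fmeasurable M" using lattice_cube_measure(1)[OF X D Q\<^sub>0] .
    show "1 \<le> max 1 (\<kappa>\<^sub>1 ^ N)" by simp
    show "measure M P \<le> max 1 (\<kappa>\<^sub>1 ^ N) * measure M Q" if "Q \<in> ?C (Suc n)" "P \<in> ?C n" "Q \<subseteq> P" for P Q n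
    proof -
      have "measure M P \<le> \<kappa>\<^sub>1 ^ N * measure M Q"
        using that by (intro parent_cube_measure_le[OF X D _ _ _ N, where k = "k + int n"]) (auto simp: add_ac)
      also have "\<dots> \<le> max 1 (\<kappa>\<^sub>1 ^ N) * measure M Q" by (intro mult_right_mono) auto
      finally show ?thesis .
    qed
    show "w \<in> borel_measurable M" using locally_integrable_borel_measurable[OF X loc] .
    show "set_integrable M Q\<^sub>0 w"
    proof -
      obtain z where z: "z \<in> Q\<^sub>0" "Q\<^sub>0 \<subseteq> qball (space M) \<rho> z (R\<^sub>0 * \<delta> powi k)"
        using lattice_cube[OF D Q\<^sub>0] by metis
      have "0 < R\<^sub>0 * \<delta> powi k" using D by (auto simp: dyadic_lattice_def)
      then have "set_integrable M (qball (space M) \<rho> z (R\<^sub>0 * \<delta> powi k)) w"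
        using loc z Q\<^sub>0s unfolding locally_integrable_def by blast
      then show ?thesis
        using z Q\<^sub>0 sets by (auto intro: set_integrable_subset)
    qed
    show "set_integrable M Q\<^sub>0 (\<lambda>x. w x powr p)"
      using RH Q\<^sub>0 by (auto simp: reverse_hoelder_bound_def)
    show "average M Q (\<lambda>x. w x powr p) \<le> (K * average M Q w) powr p" if "Q \<in> ?C n" for Q n
    proof -
      let ?a = "average M Q (\<lambda>x. w x powr p)"
      have "0 \<le> ?a"
        unfolding average_def set_lebesgue_integral_def
        by (intro divide_nonneg_nonneg Bochner_Integration.integral_nonneg) auto
      then have "?a = (?a powr (1 / p)) powr p" using pKc by (simp add: powr_powr)
      also have "\<dots> \<le> (K * average M Q w) powr p"
        using RH that pKc by (intro powr_mono2) (auto simp: reverse_hoelder_bound_def)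
      finally show ?thesis .
    qed
    show "AE x in M. x \<in> Q\<^sub>0 \<longrightarrow> (\<forall>l<w x. \<exists>n. \<exists>Q\<in>?C n. x \<in> Q \<and> l < average M Q w)"
    proof -
      have "AE x in M. ((\<lambda>k. average M (cube_at \<D> k x) w) \<longlongrightarrow> w x) at_top"
        using L loc unfolding lebesgue_differentiation_def by blast
      then show ?thesis
      proof eventually_elim
        case (elim x)
        show ?case
        proof (intro impI allI)
          fix l assume x: "x \<in> Q\<^sub>0" and l: "l < w x"
          have "eventually (\<lambda>j. l < average M (cube_at \<D> j x) w \<and> k \<le> j) at_top"
            using order_tendstoD(1)[OF elim l] eventually_ge_at_top[of k] by (rule eventually_conj)
          then obtain j where j: "l < average M (cube_at \<D> j x) w" "k \<le> j"
            using eventually_happens'[OF trivial_limit_at_top_linorder] by auto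
          obtain Q where Q: "Q \<in> ?C (nat (j - k))" "x \<in> Q" using cover[OF x] by blast
          then have "cube_at \<D> j x = Q" using j(2) by (intro cube_at_eqI[OF part]) auto
          with j(1) have "l < average M Q w" by simp
          with Q show "\<exists>n. \<exists>Q\<in>?C n. x \<in> Q \<and> l < average M Q w"
            by (intro exI[of _ "nat (j - k)"] bexI[of _ Q] conjI)
        qed
      qed
    qed
  qed (use pKc w0 in auto)
qed

theorem theorem1p1:
  fixes p K \<kappa>\<^sub>0 \<kappa>\<^sub>1 r\<^sub>0 R\<^sub>0 \<delta> :: real
  assumes "1 < p"
  shows "\<exists>\<epsilon>>0. \<forall>(M :: 'a measure) \<rho> \<D> w.
           homogeneous_type_space M \<rho> \<kappa>\<^sub>0 \<kappa>\<^sub>1 \<longrightarrow>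
           dyadic_lattice M \<rho> \<D> r\<^sub>0 R\<^sub>0 \<delta> \<longrightarrow>
           lebesgue_differentiation M \<rho> \<D> \<longrightarrow>
           w \<in> RH_dyadic M \<rho> \<D> p \<longrightarrow>
           RH_dyadic_const M \<D> p w = K \<longrightarrow>
           w \<in> RH_dyadic M \<rho> \<D> (p + \<epsilon>)"
proof -
  \<comment> \<open>Some admissible constant lies below \<open>K + 1\<close>, so the infimum \<open>K\<close> need not be shown to be
    attained; the bound \<open>1 \<le> K'\<close> keeps the decay rate \<open>\<theta>\<close> positive.\<close>
  define K' where "K' = max 1 (K + 1)"
  \<comment> \<open>The solution of \<open>c powr (1 - p) * K' powr p = 1 / 4\<close>.\<close>
  define c where "c = (4 * K' powr p) powr (1 / (p - 1))"
  \<comment> \<open>The sign condition can only be assumed at this point, since \<open>\<epsilon>\<close> is chosen before the lattice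
    that guarantees it.\<close>
  obtain N where N: "0 < r\<^sub>0 * \<delta> \<Longrightarrow> 2 * \<kappa>\<^sub>0 * R\<^sub>0 \<le> 2 ^ N * (r\<^sub>0 * \<delta>)"
  proof -
    obtain N where "2 * \<kappa>\<^sub>0 * R\<^sub>0 / (r\<^sub>0 * \<delta>) < 2 ^ N"
      using real_arch_pow[of 2] by auto
    then show thesis by (intro that[of N]) (simp add: pos_divide_less_eq)
  qed
  define A where "A = max 1 (\<kappa>\<^sub>1 ^ N)"
  define \<theta> where "\<theta> = 1 - (4 * K') powr (-p)"
  have K': "1 \<le> K'" by (simp add: K'_def)
  have K'p: "1 \<le> K' powr p" using K' assms by (simp add: ge_one_powr_ge_zero)
  have c1: "1 \<le> c"
    unfolding c_def using K'p assms by (intro ge_one_powr_ge_zero) auto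
  have "1 / (p - 1) * (1 - p) = -1"
    using assms by (simp add: field_simps)
  then have "c powr (1 - p) = (4 * K' powr p) powr (-1)"
    by (simp only: c_def powr_powr)
  also have "\<dots> = 1 / (4 * K' powr p)"
    using K'p by (intro powr_neg_one) linarith
  finally have "c powr (1 - p) = 1 / (4 * K' powr p)" .
  then have c2: "c powr (1 - p) * K' powr p \<le> 1 / 4"
    using K'p by simp
  have \<theta>: "0 < \<theta>" "\<theta> < 1"
  proof -
    have "(4 * K') powr (-p) < (4 * K') powr 0"
      using K' assms by (intro powr_less_mono) auto
    then show "0 < \<theta>" "\<theta> < 1" using K' by (simp_all add: \<theta>_def)
  qed
  have a: "4 \<le> 4 * A * c"
    using mult_mono[of 1 A 1 c] c1 by (simp add: A_def)
  \<comment> \<open>This choice makes the ratio of the geometric series the square root of \<open>\<theta>\<close>.\<close>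
  define \<epsilon> where "\<epsilon> = - ln \<theta> / (2 * ln (4 * A * c))"
  have \<epsilon>: "0 < \<epsilon>"
    unfolding \<epsilon>_def
  proof (rule divide_pos_pos)
    show "0 < - ln \<theta>" using \<theta> by simp
    have "0 < ln (4 * A * c)" using a by (intro ln_gt_zero) linarith
    then show "0 < 2 * ln (4 * A * c)" by simp
  qed
  have "(4 * A * c) powr \<epsilon> * \<theta> = exp (ln \<theta> / 2)"
  proof -
    have "ln (4 * A * c) > 0" using a by (intro ln_gt_zero) linarith
    then have "(4 * A * c) powr \<epsilon> = exp (- ln \<theta> / 2)"
      using a by (auto simp: powr_def \<epsilon>_def)
    then have "(4 * A * c) powr \<epsilon> * \<theta> = exp (- ln \<theta> / 2) * exp (ln \<theta>)" using \<theta> by simp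
    then show ?thesis by (simp flip: exp_add)
  qed
  then have conv: "(4 * A * c) powr \<epsilon> * \<theta> < 1"
    using \<theta> by simp
  show ?thesis
  proof (intro exI[of _ \<epsilon>] conjI \<epsilon> allI impI)
    fix M :: "'a measure" and \<rho> \<D> w
    assume X: "homogeneous_type_space M \<rho> \<kappa>\<^sub>0 \<kappa>\<^sub>1" and D: "dyadic_lattice M \<rho> \<D> r\<^sub>0 R\<^sub>0 \<delta>"
      and L: "lebesgue_differentiation M \<rho> \<D>" and w: "w \<in> RH_dyadic M \<rho> \<D> p"
      and K: "RH_dyadic_const M \<D> p w = K"
    have wt: "weight M \<rho> w" and ex: "\<exists>C. reverse_hoelder_bound M \<D> p w C"
      using w by (auto simp: RH_dyadic_def)
    have avg: "0 \<le> average M Q w" if "Q \<in> \<D> k" for Q k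
    proof -
      have "Q \<subseteq> space M" using D that sets.sets_into_space by (auto simp: dyadic_lattice_def)
      then show ?thesis
        using wt unfolding average_def set_lebesgue_integral_def weight_def
        by (intro divide_nonneg_nonneg Bochner_Integration.integral_nonneg) (auto split: split_indicator)
    qed
    have "Inf {C. reverse_hoelder_bound M \<D> p w C} < K'"
      using K by (simp add: RH_dyadic_const_def K'_def)
    then obtain C where C: "reverse_hoelder_bound M \<D> p w C" "C < K'"
      using ex cInf_lessD[of "{C. reverse_hoelder_bound M \<D> p w C}" K'] by auto
    have RH: "reverse_hoelder_bound M \<D> p w K'"
      using C avg by (intro reverse_hoelder_bound_mono[OF C(1)]) auto
    have N': "2 * \<kappa>\<^sub>0 * R\<^sub>0 \<le> 2 ^ N * (r\<^sub>0 * \<delta>)"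
      using D by (intro N) (auto simp: dyadic_lattice_def)
    have "reverse_hoelder_bound M \<D> (p + \<epsilon>) w
      (((1 + (4 * A * c) powr \<epsilon> / (1 - (4 * A * c) powr \<epsilon> * \<theta>)) * K' powr p) powr (1 / (p + \<epsilon>)))"
      unfolding reverse_hoelder_bound_def
    proof (intro conjI allI ballI)
      fix k Q assume Q: "Q \<in> \<D> k"
      interpret reverse_hoelder_filtration M Q "\<lambda>n. {R \<in> \<D> (k + int n). R \<subseteq> Q}" A w p K' c
        unfolding A_def
        using subcubes_reverse_hoelder_filtration[OF X D L wt RH Q N' assms K' c1 c2] .
      show "set_integrable M Q (\<lambda>x. w x powr (p + \<epsilon>))"
        using higher_power_integrable[OF \<epsilon>] conv by (simp add: \<theta>_def)
      show "average M Q (\<lambda>x. w x powr (p + \<epsilon>)) powr (1 / (p + \<epsilon>)) \<le>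
        ((1 + (4 * A * c) powr \<epsilon> / (1 - (4 * A * c) powr \<epsilon> * \<theta>)) * K' powr p) powr (1 / (p + \<epsilon>)) * average M Q w"
        using higher_power_average_le[OF \<epsilon>] conv unfolding \<theta>_def by blast
    qed simp
    then show "w \<in> RH_dyadic M \<rho> \<D> (p + \<epsilon>)"
      using wt by (auto simp: RH_dyadic_def)
  qed
qed

end
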